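(* Let $\mathbb{F}$ be $\mathbb{R}$ or $\mathbb{C}$. Let $n\ge1$ and let $\bm{a}=(a_0,a_1,\ldots,a_n)$ be a tuple of positive integers with $a_0=1$ and $a_1>\cdots>a_n\ge2$. Let $\bm{c}_i=(c_{i,0},c_{i,1},\ldots,c_{i,n})\in\mathbb{F}^{n+1}$, $1\le i\le d$, be such that $c_{1,0},c_{2,0},\ldots,c_{d,0}$ are not all zero. Define $\tau:(\mathbb{N}^{n+1})^d\to\mathbb{N}$ by $$\tau(\bm{\gamma}_1,\ldots,\bm{\gamma}_d)=\sum_{j=0}^n a_j\sum_{i=1}^d\gamma_{i,j},\qquad \bm{\gamma}_i=(\gamma_{i,0},\ldots,\gamma_{i,n})\in\mathbb{N}^{n+1}.$$ For $m=0,1,\ldots,a_1$ let $q_{n,m}\in\mathbb{F}[x_1,\ldots,x_d]$ be the polynomial $$q_{n,m}=\sum_{\tau(\bm{\gamma}_1,\ldots,\bm{\gamma}_d)=m}\frac{\bm{c}_1^{\bm{\gamma}_1}\cdots\bm{c}_d^{\bm{\gamma}_d}}{\bm{\gamma}_1!\cdots\bm{\gamma}_d!}\,x_1^{\|\bm{\gamma}_1\|_1}\cdots x_d^{\|\bm{\gamma}_d\|_1},$$ and let $\mathcal{Q}=\mathrm{span}_{\mathbb{F}}\{q_{n,m}:0\le m\le a_1\}$. Then: (i) $\dim\mathcal{Q}=a_1+1$; (ii) $\mathcal{Q}$ is a $D$-invariant polynomial subspace.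
   Context: $\mathbb{N}$ is the set of nonnegative integers. For $\bm{\gamma}_i=(\gamma_{i,0},\ldots,\gamma_{i,n})\in\mathbb{N}^{n+1}$: $\|\bm{\gamma}_i\|_1=\sum_{j=0}^n\gamma_{i,j}$, $\bm{\gamma}_i!=\prod_{j=0}^n\gamma_{i,j}!$, and $\bm{c}_i^{\bm{\gamma}_i}=\prod_{j=0}^nc_{i,j}^{\gamma_{i,j}}$ (with $0^0=1$). A linear subspace $\mathcal{Q}\subset\mathbb{F}[x_1,\ldots,x_d]$ is $D$-invariant if $\partial q/\partial x_i\in\mathcal{Q}$ for every $q\in\mathcal{Q}$ and all $1\le i\le d$. *)

theory Defs
  imports Complex_Main "HOL-Library.FuncSet" "HOL-Library.Poly_Mapping"
begin

text \<open>
  A finite type \<open>'d\<close> indexes the variables. Keys of the outer mapping are exponent vectors, and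
  the convolution product of \<open>HOL-Library.Poly_Mapping\<close> is the product of polynomials.
\<close>

type_synonym ('d, 'a) mpoly = "('d \<Rightarrow>\<^sub>0 nat) \<Rightarrow>\<^sub>0 'a"

definition mvar :: "'d \<Rightarrow> ('d, 'a::comm_semiring_1) mpoly" where
  "mvar i = Poly_Mapping.single (Poly_Mapping.single i 1) 1"

definition mscale :: "'a \<Rightarrow> ('d, 'a) mpoly \<Rightarrow> ('d, 'a::comm_semiring_1) mpoly" where
  "mscale s p = Poly_Mapping.map ((*) s) p"

lemma lookup_mscale: "Poly_Mapping.lookup (mscale s p) e = s * Poly_Mapping.lookup p e"
  by (simp add: mscale_def map.rep_eq when_def)

interpretation mpoly: vector_space "mscale :: 'a::field \<Rightarrow> ('d, 'a) mpoly \<Rightarrow> ('d, 'a) mpoly"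
  by unfold_locales
    (auto intro!: poly_mapping_eqI simp: lookup_mscale lookup_add algebra_simps)

text \<open>
  The subtraction of exponent vectors is truncated, but a monomial not containing the variable
  \<open>i\<close> contributes with coefficient \<open>0\<close>.
\<close>

definition mpderiv :: "'d \<Rightarrow> ('d, 'a) mpoly \<Rightarrow> ('d, 'a::comm_semiring_1) mpoly" where
  "mpderiv i p = (\<Sum>e\<in>Poly_Mapping.keys p.
     Poly_Mapping.single (e - Poly_Mapping.single i 1)
       (of_nat (Poly_Mapping.lookup e i) * Poly_Mapping.lookup p e))"

lemma lookup_mpderiv:
  "Poly_Mapping.lookup (mpderiv i p) e =
     of_nat (Suc (Poly_Mapping.lookup e i)) * Poly_Mapping.lookup p (e + Poly_Mapping.single i 1)"
proof -
  let ?s = "Poly_Mapping.single i (1::nat)"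
  let ?f = "\<lambda>u. of_nat (Poly_Mapping.lookup u i) * Poly_Mapping.lookup p u"
  have key: "(u - ?s = e \<and> ?f u \<noteq> 0) \<longleftrightarrow> (u = e + ?s \<and> ?f u \<noteq> 0)" for u
  proof -
    have "u - ?s + ?s = u" if "Poly_Mapping.lookup u i \<noteq> 0"
      using that by (intro poly_mapping_eqI) (auto simp: lookup_add lookup_minus lookup_single when_def)
    then show ?thesis by (metis add_diff_cancel_right' mult_zero_left of_nat_0)
  qed
  have "Poly_Mapping.lookup (mpderiv i p) e =
      (\<Sum>u\<in>Poly_Mapping.keys p. if u - ?s = e then ?f u else 0)"
    by (simp add: mpderiv_def lookup_sum lookup_single when_def)
  also have "\<dots> = (\<Sum>u\<in>Poly_Mapping.keys p. if u = e + ?s then ?f u else 0)"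
  proof (intro sum.cong refl)
    fix u
    show "(if u - ?s = e then ?f u else 0) = (if u = e + ?s then ?f u else 0)"
      using key[of u] by presburger
  qed
  also have "\<dots> = ?f (e + ?s)"
    by (auto simp: sum.delta in_keys_iff)
  finally show ?thesis by (simp add: lookup_add)
qed

definition D_invariant :: "('d, 'a::field) mpoly set \<Rightarrow> bool" where
  "D_invariant Q \<longleftrightarrow> mpoly.subspace Q \<and> (\<forall>q\<in>Q. \<forall>i. mpderiv i q \<in> Q)"

text \<open>
  A vector indexed by \<open>0, \<dots>, n\<close> is a function on \<open>nat\<close> of which only these values matter.
  Multi-indices additionally vanish beyond \<open>n\<close>, so that each of them is represented exactly once
  in the sum defining \<open>q_poly\<close>.
\<close>

definition multi_indices :: "nat \<Rightarrow> (nat \<Rightarrow> nat) set" where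
  "multi_indices n = {g. \<forall>j>n. g j = 0}"

definition norm1 :: "nat \<Rightarrow> (nat \<Rightarrow> nat) \<Rightarrow> nat" where
  "norm1 n g = (\<Sum>j\<le>n. g j)"

definition mfact :: "nat \<Rightarrow> (nat \<Rightarrow> nat) \<Rightarrow> nat" where
  "mfact n g = (\<Prod>j\<le>n. fact (g j))"

definition mpow :: "nat \<Rightarrow> (nat \<Rightarrow> 'a::comm_semiring_1) \<Rightarrow> (nat \<Rightarrow> nat) \<Rightarrow> 'a" where
  "mpow n v g = (\<Prod>j\<le>n. v j ^ g j)"

definition tau :: "nat \<Rightarrow> (nat \<Rightarrow> nat) \<Rightarrow> ('d::finite \<Rightarrow> nat \<Rightarrow> nat) \<Rightarrow> nat" where
  "tau n a \<gamma> = (\<Sum>j\<le>n. a j * (\<Sum>i\<in>UNIV. \<gamma> i j))"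

definition tau_fiber :: "nat \<Rightarrow> (nat \<Rightarrow> nat) \<Rightarrow> nat \<Rightarrow> ('d::finite \<Rightarrow> nat \<Rightarrow> nat) set" where
  "tau_fiber n a m = {\<gamma>. (\<forall>i. \<gamma> i \<in> multi_indices n) \<and> tau n a \<gamma> = m}"

lemma finite_tau_fiber:
  assumes "\<And>j. j \<le> n \<Longrightarrow> 0 < a j"
  shows "finite (tau_fiber n a m :: ('d::finite \<Rightarrow> nat \<Rightarrow> nat) set)"
proof -
  let ?B = "{g :: nat \<Rightarrow> nat. \<forall>j. (j \<in> {..n} \<longrightarrow> g j \<in> {..m}) \<and> (j \<notin> {..n} \<longrightarrow> g j = 0)}"
  have "\<gamma> i j \<le> m" if "tau n a \<gamma> = m" "j \<le> n" for \<gamma> :: "'d \<Rightarrow> nat \<Rightarrow> nat" and i j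
  proof -
    have "\<gamma> i j \<le> (\<Sum>i\<in>UNIV. \<gamma> i j)" by (intro member_le_sum) auto
    also have "\<dots> \<le> a j * (\<Sum>i\<in>UNIV. \<gamma> i j)" using assms[OF that(2)] by simp
    also have "\<dots> \<le> tau n a \<gamma>" unfolding tau_def using that(2)
      by (intro member_le_sum[of j "{..n}" "\<lambda>j. a j * (\<Sum>i\<in>UNIV. \<gamma> i j)"]) auto
    finally show ?thesis using that(1) by simp
  qed
  then have "tau_fiber n a m \<subseteq> (UNIV :: 'd set) \<rightarrow>\<^sub>E ?B"
    by (auto simp: tau_fiber_def multi_indices_def)
  moreover have "finite ?B" by (rule finite_set_of_finite_funs) auto
  ultimately show ?thesis by (meson finite_PiE finite_UNIV finite_subset)
qed

definition q_poly ::
  "nat \<Rightarrow> (nat \<Rightarrow> nat) \<Rightarrow> ('d::finite \<Rightarrow> nat \<Rightarrow> 'a::field) \<Rightarrow> nat \<Rightarrow> ('d, 'a) mpoly" where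
  "q_poly n a c m = (\<Sum>\<gamma>\<in>tau_fiber n a m.
     mscale ((\<Prod>i\<in>UNIV. mpow n (c i) (\<gamma> i)) / of_nat (\<Prod>i\<in>UNIV. mfact n (\<gamma> i)))
       (\<Prod>i\<in>UNIV. mvar i ^ norm1 n (\<gamma> i)))"

definition Q_space ::
  "nat \<Rightarrow> (nat \<Rightarrow> nat) \<Rightarrow> ('d::finite \<Rightarrow> nat \<Rightarrow> 'a::field) \<Rightarrow> ('d, 'a) mpoly set" where
  "Q_space n a c = mpoly.span (q_poly n a c ` {0..a 1})"

end

theory Submission
  imports Defs
begin

text \<open>
  The polynomials have the generating function
  \<open>\<Sum>m. q\<^sub>m t^m = exp (\<Sum>i. x\<^sub>i * (\<Sum>j. c\<^sub>i\<^sub>j * t^(a\<^sub>j)))\<close>, so that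
  \<open>\<partial>q\<^sub>m / \<partial>x\<^sub>i = (\<Sum>j. c\<^sub>i\<^sub>j q\<^sub>m\<^sub>-\<^sub>a\<^sub>j)\<close>, where terms with \<open>a\<^sub>j > m\<close> are dropped. On coefficients this
  is the bijection that raises \<open>\<gamma>\<^sub>i\<^sub>j\<close> by one. If \<open>c\<^sub>k\<^sub>0 \<noteq> 0\<close>, the coefficient of \<open>x\<^sub>k^m\<close> in \<open>q\<^sub>m\<close> is
  \<open>c\<^sub>k\<^sub>0^m / m!\<close> and it vanishes in \<open>q\<^sub>l\<close> for \<open>l < m\<close>, because \<open>a\<^sub>0 = 1\<close> and \<open>a\<^sub>j \<ge> 2\<close> for \<open>j \<ge> 1\<close>;
  this triangular
  shape gives linear independence.
\<close>

section \<open>Coefficients of \<open>q_poly\<close> as sums over multi-indices\<close>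

definition weight :: "nat \<Rightarrow> ('d::finite \<Rightarrow> nat \<Rightarrow> 'a::field_char_0) \<Rightarrow> ('d \<Rightarrow> nat \<Rightarrow> nat) \<Rightarrow> 'a" where
  "weight n c \<gamma> = (\<Prod>i\<in>UNIV. \<Prod>j\<le>n. c i j ^ \<gamma> i j / fact (\<gamma> i j))"

text \<open>Distinct multi-indices can produce the same monomial; this set collects those in the sum
  for index \<open>m\<close> whose monomial has exponent vector \<open>e\<close>.\<close>

definition graded_fiber ::
  "nat \<Rightarrow> (nat \<Rightarrow> nat) \<Rightarrow> nat \<Rightarrow> ('d::finite \<Rightarrow>\<^sub>0 nat) \<Rightarrow> ('d \<Rightarrow> nat \<Rightarrow> nat) set" where
  "graded_fiber n a m e =
     {\<gamma> \<in> tau_fiber n a m. \<forall>i. norm1 n (\<gamma> i) = Poly_Mapping.lookup e i}"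

definition raise :: "'d \<Rightarrow> nat \<Rightarrow> ('d \<Rightarrow> nat \<Rightarrow> nat) \<Rightarrow> 'd \<Rightarrow> nat \<Rightarrow> nat" where
  "raise k j \<gamma> = \<gamma>(k := (\<gamma> k)(j := Suc (\<gamma> k j)))"

definition lower :: "'d \<Rightarrow> nat \<Rightarrow> ('d \<Rightarrow> nat \<Rightarrow> nat) \<Rightarrow> 'd \<Rightarrow> nat \<Rightarrow> nat" where
  "lower k j \<gamma> = \<gamma>(k := (\<gamma> k)(j := \<gamma> k j - 1))"

lemma lower_raise: "lower k j (raise k j \<gamma>) = \<gamma>"
  by (simp add: lower_def raise_def)

lemma raise_lower: "0 < \<gamma> k j \<Longrightarrow> raise k j (lower k j \<gamma>) = \<gamma>"
  by (simp add: lower_def raise_def)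

lemma raise_apply_same: "raise k j \<gamma> k j = Suc (\<gamma> k j)"
  by (simp add: raise_def)

lemma mvar_power: "mvar i ^ r = Poly_Mapping.single (Poly_Mapping.single i r) 1"
  by (induction r) (simp_all add: mvar_def mult_single flip: single_add)

lemma prod_mvar_power:
  "(\<Prod>i\<in>A. mvar i ^ f i) = Poly_Mapping.single (\<Sum>i\<in>A. Poly_Mapping.single i (f i)) 1"
  by (induction A rule: infinite_finite_induct) (simp_all add: mvar_power mult_single)

lemma lookup_prod_mvar_power:
  fixes e :: "'d::finite \<Rightarrow>\<^sub>0 nat"
  shows "Poly_Mapping.lookup (\<Prod>i\<in>UNIV. mvar i ^ f i) e =
    (if \<forall>i. f i = Poly_Mapping.lookup e i then 1 else 0)"
proof -
  have "Poly_Mapping.lookup (\<Sum>i\<in>UNIV. Poly_Mapping.single i (f i)) k = f k" for k :: 'd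
    by (simp add: lookup_sum lookup_single when_def)
  then show ?thesis
    by (auto simp: prod_mvar_power lookup_single when_def poly_mapping_eq_iff fun_eq_iff)
qed

text \<open>Pairs each power with its own factorial, so that \<open>weight_raise\<close> can split
  off the factor at one position.\<close>

lemma weight_altdef:
  "(\<Prod>i\<in>UNIV. mpow n (c i) (\<gamma> i)) / of_nat (\<Prod>i\<in>UNIV. mfact n (\<gamma> i)) = weight n c \<gamma>"
  by (simp add: weight_def mpow_def mfact_def prod_dividef)

lemma finite_graded_fiber:
  fixes e :: "'d::finite \<Rightarrow>\<^sub>0 nat"
  assumes "\<And>j. j \<le> n \<Longrightarrow> 0 < a j"
  shows "finite (graded_fiber n a m e)"
  using finite_tau_fiber[OF assms, where ?'d = 'd] by (simp add: graded_fiber_def)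

lemma lookup_q_poly:
  fixes c :: "'d::finite \<Rightarrow> nat \<Rightarrow> 'a::field_char_0"
  assumes "\<And>j. j \<le> n \<Longrightarrow> 0 < a j"
  shows "Poly_Mapping.lookup (q_poly n a c m) e = (\<Sum>\<gamma>\<in>graded_fiber n a m e. weight n c \<gamma>)"
proof -
  have "Poly_Mapping.lookup (q_poly n a c m) e =
      (\<Sum>\<gamma>\<in>tau_fiber n a m.
         if \<forall>i. norm1 n (\<gamma> i) = Poly_Mapping.lookup e i then weight n c \<gamma> else 0)"
    unfolding q_poly_def weight_altdef lookup_sum lookup_mscale lookup_prod_mvar_power
    by (intro sum.cong) auto
  also have "\<dots> = (\<Sum>\<gamma>\<in>graded_fiber n a m e. weight n c \<gamma>)"
    unfolding graded_fiber_def
    using finite_tau_fiber[OF assms, where ?'d = 'd] by (simp add: sum.inter_filter)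
  finally show ?thesis .
qed

section \<open>Raising an entry, and the derivatives of \<open>q_poly\<close>\<close>

lemma norm1_raise:
  assumes "j \<le> n"
  shows "norm1 n (raise k j \<gamma> i) = norm1 n (\<gamma> i) + (if i = k then 1 else 0)"
  using assms by (auto simp: norm1_def raise_def sum.remove[of _ j])

lemma tau_raise:
  assumes "j \<le> n"
  shows "tau n a (raise k j \<gamma>) = tau n a \<gamma> + a j"
proof -
  have col: "(\<Sum>i\<in>UNIV. raise k j \<gamma> i l) = (\<Sum>i\<in>UNIV. \<gamma> i l) + (if l = j then 1 else 0)" for l
    by (auto simp: raise_def sum.remove[of UNIV k])
  show ?thesis
    unfolding tau_def col
    using assms by (simp add: distrib_left sum.distrib if_distrib[of "(*) _"] cong: if_cong)
qed

lemma raise_multi_indices: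
  assumes "j \<le> n"
  shows "raise k j \<gamma> i \<in> multi_indices n \<longleftrightarrow> \<gamma> i \<in> multi_indices n"
  using assms by (auto simp: raise_def multi_indices_def)

text \<open>Raising adds 1 to the exponent of variable \<open>k\<close> and \<open>a j\<close> to
  \<open>tau\<close>. The conjunct \<open>a j \<le> m\<close> is essential because
  \<open>m - a j\<close> is truncated.\<close>

lemma raise_in_graded_fiber:
  assumes "j \<le> n"
  shows "raise k j \<gamma> \<in> graded_fiber n a m (e + Poly_Mapping.single k 1) \<longleftrightarrow>
    a j \<le> m \<and> \<gamma> \<in> graded_fiber n a (m - a j) e"
proof -
  have "norm1 n (raise k j \<gamma> i) = Poly_Mapping.lookup (e + Poly_Mapping.single k 1) i \<longleftrightarrow>
      norm1 n (\<gamma> i) = Poly_Mapping.lookup e i" for i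
    by (simp add: norm1_raise[OF assms] lookup_add lookup_single when_def)
  moreover have "tau n a \<gamma> + a j = m \<longleftrightarrow> a j \<le> m \<and> tau n a \<gamma> = m - a j"
    by auto
  ultimately show ?thesis
    by (auto simp: graded_fiber_def tau_fiber_def raise_multi_indices[OF assms] tau_raise[OF assms])
qed

text \<open>Only the factor at position \<open>(k, j)\<close> changes, and there
  \<open>s * x^s / s! = x * x^(s-1) / (s-1)!\<close> with
  \<open>s = Suc (\<gamma> k j)\<close>.\<close>

lemma weight_raise:
  fixes c :: "'d::finite \<Rightarrow> nat \<Rightarrow> 'a::field_char_0"
  assumes "j \<le> n"
  shows "of_nat (raise k j \<gamma> k j) * weight n c (raise k j \<gamma>) = c k j * weight n c \<gamma>"
proof -
  define f where "f \<gamma> i l = c i l ^ \<gamma> i l / fact (\<gamma> i l)" for \<gamma> :: "'d \<Rightarrow> nat \<Rightarrow> nat" and i l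
  \<comment> \<open>The factors that raising leaves alone: the rest of row \<open>k\<close> and all
    other rows.\<close>
  define R where
    "R \<gamma> = (\<Prod>l\<in>{..n} - {j}. f \<gamma> k l) * (\<Prod>i\<in>UNIV - {k}. \<Prod>l\<le>n. f \<gamma> i l)" for \<gamma>
  have split: "weight n c \<gamma> = f \<gamma> k j * R \<gamma>" for \<gamma>
    using assms
    by (simp add: weight_def f_def R_def prod.remove[of UNIV k] prod.remove[of "{..n}" j])
  have "R (raise k j \<gamma>) = R \<gamma>"
    unfolding R_def f_def raise_def by (intro arg_cong2[of _ _ _ _ "(*)"] prod.cong) auto
  moreover have "of_nat (raise k j \<gamma> k j) * f (raise k j \<gamma>) k j = c k j * f \<gamma> k j"
    by (simp add: f_def raise_def del: of_nat_Suc)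
  ultimately show ?thesis
    by (simp add: split flip: mult.assoc)
qed

text \<open>The factor \<open>\<gamma> k j\<close> kills every multi-index that is not of the form
  \<open>raise k j _\<close>; the remaining ones are reindexed by \<open>lower k j\<close>.\<close>

lemma sum_weight_raise:
  fixes c :: "'d::finite \<Rightarrow> nat \<Rightarrow> 'a::field_char_0"
  assumes pos: "\<And>j. j \<le> n \<Longrightarrow> 0 < a j" and j: "j \<le> n"
  shows "(\<Sum>\<gamma>\<in>graded_fiber n a m (e + Poly_Mapping.single k 1). of_nat (\<gamma> k j) * weight n c \<gamma>) =
    (if a j \<le> m then c k j * (\<Sum>\<gamma>\<in>graded_fiber n a (m - a j) e. weight n c \<gamma>) else 0)"
    (is "sum ?f ?S = _")
proof -
  \<comment> \<open>Moving the condition \<open>a j \<le> m\<close> into the set makes it empty in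
    the other case, so one reindexing covers both branches.\<close>
  let ?T = "{\<gamma>. a j \<le> m \<and> \<gamma> \<in> graded_fiber n a (m - a j) e}"
  \<comment> \<open>Positivity of \<open>\<gamma> k j\<close> is what makes \<open>lower\<close>,
    with its truncated subtraction, a true inverse of \<open>raise\<close>.\<close>
  have "sum ?f ?S = sum ?f {\<gamma> \<in> ?S. 0 < \<gamma> k j}"
    using finite_graded_fiber[OF pos] by (intro sum.mono_neutral_right) auto
  also have "\<dots> = (\<Sum>\<gamma>\<in>?T. c k j * weight n c \<gamma>)"
  proof (rule sum.reindex_bij_witness[of _ "raise k j" "lower k j"])
    fix \<gamma> assume \<gamma>: "\<gamma> \<in> {\<gamma> \<in> ?S. 0 < \<gamma> k j}"
    then show up: "raise k j (lower k j \<gamma>) = \<gamma>"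
      by (simp add: raise_lower)
    show "lower k j \<gamma> \<in> ?T"
      using \<gamma> raise_in_graded_fiber[OF j, of k "lower k j \<gamma>"] by (simp add: up)
    show "c k j * weight n c (lower k j \<gamma>) = ?f \<gamma>"
      using weight_raise[OF j, of k "lower k j \<gamma>" c] by (simp add: up)
  next
    fix \<gamma> assume \<gamma>: "\<gamma> \<in> ?T"
    show "lower k j (raise k j \<gamma>) = \<gamma>"
      by (rule lower_raise)
    show "raise k j \<gamma> \<in> {\<gamma> \<in> ?S. 0 < \<gamma> k j}"
      using \<gamma> raise_in_graded_fiber[OF j, of k \<gamma> a m e]
      by (simp add: raise_apply_same)
  qed
  finally show ?thesis
    by (simp add: sum_distrib_left)
qed

text \<open>Differentiation multiplies a coefficient by the exponent of variable \<open>k\<close>.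
  This exponent is the sum of the entries \<open>\<gamma> k j\<close>, and
  \<open>sum_weight_raise\<close> evaluates the share of each \<open>j\<close>.\<close>

lemma mpderiv_q_poly:
  fixes c :: "'d::finite \<Rightarrow> nat \<Rightarrow> 'a::field_char_0"
  assumes pos: "\<And>j. j \<le> n \<Longrightarrow> 0 < a j"
  shows "mpderiv k (q_poly n a c m) =
    (\<Sum>j\<le>n. if a j \<le> m then mscale (c k j) (q_poly n a c (m - a j)) else 0)"
proof (rule poly_mapping_eqI)
  fix e :: "'d \<Rightarrow>\<^sub>0 nat"
  let ?S = "graded_fiber n a m (e + Poly_Mapping.single k 1)"
  have row: "of_nat (Suc (Poly_Mapping.lookup e k)) = (\<Sum>j\<le>n. of_nat (\<gamma> k j) :: 'a)"
    if "\<gamma> \<in> ?S" for \<gamma>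
  proof -
    have "norm1 n (\<gamma> k) = Suc (Poly_Mapping.lookup e k)"
      using that by (simp add: graded_fiber_def lookup_add)
    then show ?thesis
      unfolding norm1_def by (simp flip: of_nat_sum del: of_nat_Suc)
  qed
  have coeff: "Poly_Mapping.lookup (q_poly n a c m) e = (\<Sum>\<gamma>\<in>graded_fiber n a m e. weight n c \<gamma>)"
    for m e
    by (rule lookup_q_poly) (rule pos)
  have "Poly_Mapping.lookup (mpderiv k (q_poly n a c m)) e =
      (\<Sum>\<gamma>\<in>?S. \<Sum>j\<le>n. of_nat (\<gamma> k j) * weight n c \<gamma>)"
    unfolding lookup_mpderiv coeff sum_distrib_left
    by (rule sum.cong[OF refl]) (simp only: row sum_distrib_right)
  also have "\<dots> = (\<Sum>j\<le>n. \<Sum>\<gamma>\<in>?S. of_nat (\<gamma> k j) * weight n c \<gamma>)"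
    by (rule sum.swap)
  also have "\<dots> = Poly_Mapping.lookup
      (\<Sum>j\<le>n. if a j \<le> m then mscale (c k j) (q_poly n a c (m - a j)) else 0) e"
    unfolding lookup_sum
  proof (rule sum.cong[OF refl])
    fix j assume "j \<in> {..n}"
    then have "j \<le> n" by simp
    from sum_weight_raise[of n a, OF pos this, where m = m and e = e and k = k and c = c]
    show "(\<Sum>\<gamma>\<in>?S. of_nat (\<gamma> k j) * weight n c \<gamma>) = Poly_Mapping.lookup
        (if a j \<le> m then mscale (c k j) (q_poly n a c (m - a j)) else 0) e"
      by (simp add: lookup_mscale coeff)
  qed
  finally show "Poly_Mapping.lookup (mpderiv k (q_poly n a c m)) e = \<dots>" .
qed

section \<open>Invariance of spans under differentiation\<close>

lemma linear_mpderiv: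
  "Vector_Spaces.linear mscale mscale (mpderiv i :: ('d, 'a::field) mpoly \<Rightarrow> _)"
  by unfold_locales
    (auto intro!: poly_mapping_eqI simp: lookup_mpderiv lookup_mscale lookup_add algebra_simps)

text \<open>Differentiation is linear, so testing the generators suffices.\<close>

lemma D_invariant_span:
  assumes "\<And>i p. p \<in> B \<Longrightarrow> mpderiv i p \<in> mpoly.span B"
  shows "D_invariant (mpoly.span B)"
proof -
  have "mpderiv i q \<in> mpoly.span B" if "q \<in> mpoly.span B" for i q
  proof -
    interpret Vector_Spaces.linear mscale mscale "mpderiv i :: ('a, 'b) mpoly \<Rightarrow> _"
      by (rule linear_mpderiv)
    show ?thesis
      using that
    proof (induction rule: mpoly.span_induct_alt)
      case base
      then show ?case by (simp add: zero mpoly.span_zero)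
    next
      case (step s x y)
      then show ?case
        by (simp add: add scale assms mpoly.span_add mpoly.span_scale)
    qed
  qed
  then show ?thesis
    by (simp add: D_invariant_def)
qed

section \<open>Linear independence by leading coefficients\<close>

lemma norm1_sum_add_le_tau:
  fixes \<gamma> :: "'d::finite \<Rightarrow> nat \<Rightarrow> nat"
  assumes "a 0 = 1" and ge2: "\<And>j. \<lbrakk>0 < j; j \<le> n\<rbrakk> \<Longrightarrow> 2 \<le> a j"
  shows "(\<Sum>i\<in>UNIV. norm1 n (\<gamma> i)) + (\<Sum>j\<in>{1..n}. \<Sum>i\<in>UNIV. \<gamma> i j) \<le> tau n a \<gamma>"
proof -
  let ?s = "\<lambda>j. \<Sum>i\<in>UNIV. \<gamma> i j"
  have split: "{..n} = insert 0 {1..n}" by auto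
  have "(\<Sum>i\<in>UNIV. norm1 n (\<gamma> i)) = (\<Sum>j\<le>n. ?s j)"
    unfolding norm1_def by (rule sum.swap)
  also have "\<dots> = ?s 0 + sum ?s {1..n}"
    by (simp add: split)
  \<comment> \<open>The entries in columns \<open>1..n\<close> are counted twice on the left, which
    \<open>tau\<close> can afford since it weights them by \<open>a j \<ge> 2\<close>.\<close>
  finally have "(\<Sum>i\<in>UNIV. norm1 n (\<gamma> i)) + sum ?s {1..n} = ?s 0 + (\<Sum>j\<in>{1..n}. 2 * ?s j)"
    by (simp flip: sum_distrib_left)
  also have "\<dots> \<le> ?s 0 + (\<Sum>j\<in>{1..n}. a j * ?s j)"
    using ge2 by (intro add_left_mono sum_mono mult_right_mono) auto
  also have "\<dots> = tau n a \<gamma>"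
    using \<open>a 0 = 1\<close> by (simp add: tau_def split)
  finally show ?thesis .
qed

text \<open>For the monomial \<open>x_k^m\<close> the norms add up to \<open>m\<close>, while
  \<open>tau\<close> is \<open>l \<le> m\<close>. By \<open>norm1_sum_add_le_tau\<close> this forces
  \<open>l = m\<close> and leaves no room for entries in columns \<open>1..n\<close>, so the whole
  exponent sits in row \<open>k\<close>, column 0.\<close>

lemma graded_fiber_single:
  fixes k :: "'d::finite"
  assumes a0: "a 0 = 1" and ge2: "\<And>j. \<lbrakk>0 < j; j \<le> n\<rbrakk> \<Longrightarrow> 2 \<le> a j" and "l \<le> m"
  shows "graded_fiber n a l (Poly_Mapping.single k m) =
    (if l = m then {\<lambda>i j. if i = k \<and> j = 0 then m else 0} else {})"
proof -
  let ?g = "\<lambda>i j. if i = k \<and> j = 0 then m else 0"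
  have only: "l = m \<and> \<gamma> = ?g" if \<gamma>: "\<gamma> \<in> graded_fiber n a l (Poly_Mapping.single k m)" for \<gamma>
  proof -
    have norm: "norm1 n (\<gamma> i) = (if i = k then m else 0)" for i
      using \<gamma> by (simp add: graded_fiber_def lookup_single when_def)
    then have "m + (\<Sum>j\<in>{1..n}. \<Sum>i\<in>UNIV. \<gamma> i j) \<le> l"
      using norm1_sum_add_le_tau[of a n \<gamma>, OF a0 ge2] \<gamma>
      by (simp add: graded_fiber_def tau_fiber_def)
    with \<open>l \<le> m\<close> have "l = m" and "(\<Sum>j\<in>{1..n}. \<Sum>i\<in>UNIV. \<gamma> i j) = 0"
      by linarith+
    then have "\<gamma> i j = 0" if "0 < j" "j \<le> n" for i j
      using that by simp
    moreover have "\<gamma> i j = 0" if "n < j" for i j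
      using \<gamma> that by (auto simp: graded_fiber_def tau_fiber_def multi_indices_def)
    ultimately have zero: "\<gamma> i j = 0" if "0 < j" for i j
      using that by (meson not_le)
    have "norm1 n (\<gamma> i) = \<gamma> i 0" for i
      using zero by (simp add: norm1_def sum.remove[of _ 0])
    then have "\<gamma> i j = ?g i j" for i j
      using norm[of i] zero[of j i] by (cases "j = 0") auto
    with \<open>l = m\<close> show ?thesis
      by blast
  qed
  then have "\<gamma> = ?g" if "\<gamma> \<in> graded_fiber n a l (Poly_Mapping.single k m)" for \<gamma>
    using that by blast
  moreover have "?g \<in> graded_fiber n a m (Poly_Mapping.single k m)"
  proof -
    define g :: "'d \<Rightarrow> nat \<Rightarrow> nat" where "g = ?g"
    have "(\<Sum>i\<in>UNIV. g i j) = (if j = 0 then m else 0)" for j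
      by (cases "j = 0") (simp_all add: g_def)
    moreover have "norm1 n (g i) = (if i = k then m else 0)" for i
      by (cases "i = k") (simp_all add: norm1_def g_def)
    moreover have "g i \<in> multi_indices n" for i
      by (simp add: multi_indices_def g_def)
    ultimately have "g \<in> graded_fiber n a m (Poly_Mapping.single k m)"
      using a0 by (simp add: graded_fiber_def tau_fiber_def tau_def lookup_single when_def
        if_distrib[of "(*) _"] cong: if_cong)
    then show ?thesis
      by (simp only: g_def)
  qed
  ultimately have "graded_fiber n a l (Poly_Mapping.single k m) = {?g}" if "l = m"
    using that by blast
  with only show ?thesis
    by (cases "l = m") (simp_all, blast)
qed

text \<open>By induction on \<open>r\<close>: the coefficient of \<open>x_k^r\<close> separates the
  new polynomial from the span of the previous ones. The cardinality is carried along because the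
  image could identify equal polynomials, and the dimension counts its elements.\<close>

lemma independent_q_poly:
  fixes c :: "'d::finite \<Rightarrow> nat \<Rightarrow> 'a::field_char_0"
  assumes a0: "a 0 = 1" and ge2: "\<And>j. \<lbrakk>0 < j; j \<le> n\<rbrakk> \<Longrightarrow> 2 \<le> a j" and c: "c k 0 \<noteq> 0"
  shows "mpoly.independent (q_poly n a c ` {..<r}) \<and> card (q_poly n a c ` {..<r}) = r"
proof (induction r)
  case 0
  then show ?case by (simp add: mpoly.independent_empty)
next
  case (Suc r)
  let ?q = "q_poly n a c" and ?e = "Poly_Mapping.single k r"
  have pos: "0 < a j" if "j \<le> n" for j
    using a0 ge2[of j] that by (cases "j = 0") auto
  note coeff = lookup_q_poly[OF pos] graded_fiber_single[of a n, OF a0 ge2]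
  \<comment> \<open>The kernel of a coefficient functional contains a span once it contains the
    generators.\<close>
  have "mpoly.subspace {p :: ('d, 'a) mpoly. Poly_Mapping.lookup p ?e = 0}"
    by (rule mpoly.subspaceI) (auto simp: lookup_add lookup_mscale)
  then have "mpoly.span (?q ` {..<r}) \<subseteq> {p. Poly_Mapping.lookup p ?e = 0}"
    by (intro mpoly.span_minimal) (auto simp: coeff)
  \<comment> \<open>The value is \<open>c k 0 ^ r / fact r\<close>, whose denominator is nonzero in
    characteristic 0.\<close>
  moreover have "Poly_Mapping.lookup (?q r) ?e \<noteq> 0"
    using c by (simp add: coeff weight_def)
  ultimately have notin: "?q r \<notin> mpoly.span (?q ` {..<r})"
    by blast
  then have "?q r \<notin> ?q ` {..<r}"
    using mpoly.span_base[of "?q r"] by metis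
  then show ?case
    using Suc.IH notin by (simp add: lessThan_Suc mpoly.independent_insertI)
qed

text \<open>The class \<open>real_normed_field\<close> covers both the real and the complex
  numbers.\<close>

theorem proposition5:
  fixes n :: nat
    and a :: "nat \<Rightarrow> nat"
    and c :: "'d::finite \<Rightarrow> nat \<Rightarrow> 'a::real_normed_field"
  assumes "n \<ge> 1"
    and "\<And>j. j \<le> n \<Longrightarrow> a j > 0"
    and "a 0 = 1"
    and "strict_antimono_on {1..n} a"
    and "a n \<ge> 2"
    and "\<exists>i. c i 0 \<noteq> 0"
  shows "mpoly.dim (Q_space n a c) = a 1 + 1 \<and> D_invariant (Q_space n a c)"
proof
  let ?q = "q_poly n a c"
  \<comment> \<open>By strict decrease, \<open>a n\<close> is the least of the values on
    \<open>1..n\<close>, so its lower bound passes to all of them.\<close>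
  have ge2: "2 \<le> a j" if "0 < j" "j \<le> n" for j
  proof (cases "j = n")
    case False
    with that have "a n < a j"
      by (intro monotone_onD[OF assms(4)]) auto
    with \<open>a n \<ge> 2\<close> show ?thesis by simp
  qed (use \<open>a n \<ge> 2\<close> in simp)
  obtain k where "c k 0 \<noteq> 0"
    using assms(6) by blast
  note indep = independent_q_poly[of a n c, OF assms(3) ge2 this]
  have "{0..a 1} = {..<Suc (a 1)}" by auto
  then show "mpoly.dim (Q_space n a c) = a 1 + 1"
    using indep[of "Suc (a 1)"] by (simp add: Q_space_def mpoly.dim_eq_card_independent)
  show "D_invariant (Q_space n a c)"
    unfolding Q_space_def
  proof (rule D_invariant_span)
    fix i p assume "p \<in> ?q ` {0..a 1}"
    then obtain m where "m \<le> a 1" "p = ?q m" by auto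
    \<comment> \<open>The index \<open>m - a j\<close> never exceeds \<open>a 1\<close>. For
      \<open>a j > m\<close> it is truncated to 0, but the conditional in the derivative formula
      drops that term.\<close>
    then have "mscale (c i j) (?q (m - a j)) \<in> mpoly.span (?q ` {0..a 1})" for j
      by (intro mpoly.span_scale mpoly.span_base imageI) auto
    moreover have "mpderiv i p =
        (\<Sum>j\<le>n. if a j \<le> m then mscale (c i j) (?q (m - a j)) else 0)"
      unfolding \<open>p = ?q m\<close> by (rule mpderiv_q_poly) (rule assms(2))
    ultimately show "mpderiv i p \<in> mpoly.span (?q ` {0..a 1})"
      by (auto intro!: mpoly.span_sum simp: mpoly.span_zero)
  qed
qed

end
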